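(* Let $n\ge 1$ and $l\ge 2$ be integers and let $H$ be an abelian semi-regular subgroup of $\mathrm{Sym}_n$. Then $S_{n,l}(H)$ is a submonoid of its universal group $$G=\mathrm{gr}(x_1,\dots, x_n\mid x_{i_1}x_{i_2}\cdots x_{i_l}=x_{\sigma(i_1)}x_{\sigma(i_2)}\cdots x_{\sigma(i_l)}, \text{ for all } i_1,i_2,\dots ,i_l \in\{1,2,\dots ,n\} \text{ and } \sigma\in H),$$ that is, the natural monoid homomorphism $S_{n,l}(H)\to G$ sending each generator $x_i$ to $x_i$ is injective.
   Context: $\mathrm{Sym}_n$ is the symmetric group on $\{1,\dots,n\}$. For a subgroup $H$ of $\mathrm{Sym}_n$ and an integer $l\ge 2$, $S_{n,l}(H)$ is the monoid given by the presentation $$S_{n,l}(H)=\langle x_1,\dots ,x_n\mid x_{i_1}x_{i_2}\cdots x_{i_l} =x_{\sigma (i_1)} x_{\sigma (i_2)} \cdots x_{\sigma (i_l)},\ \sigma \in H,\ i_1,\ldots ,i_l \in \{1,\ldots ,n\}\rangle.$$ $\mathrm{gr}(\,\cdot\mid\cdot\,)$ denotes the group with the given generators and relations. A subgroup $H$ of $\mathrm{Sym}_n$ is semi-regular if for every $i\in\{1,\dots,n\}$ the stabilizer $H_i=\{\sigma\in H\mid \sigma(i)=i\}$ is trivial. *)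

theory Defs
  imports "HOL-Algebra.Sym_Groups"
begin

text \<open>
  The free monoid on \<open>X\<close> is \<open>lists X\<close> with concatenation; \<open>mon_cong X R\<close> is the least
  monoid congruence on it that contains the relations in \<open>R\<close>.
\<close>

inductive_set mon_cong :: "'a set \<Rightarrow> ('a list \<times> 'a list) set \<Rightarrow> ('a list \<times> 'a list) set"
  for X :: "'a set" and R :: "('a list \<times> 'a list) set" where
  mc_refl: "w \<in> lists X \<Longrightarrow> (w, w) \<in> mon_cong X R"
| mc_rel: "(u, v) \<in> R \<Longrightarrow> u \<in> lists X \<Longrightarrow> v \<in> lists X \<Longrightarrow> (u, v) \<in> mon_cong X R"
| mc_sym: "(u, v) \<in> mon_cong X R \<Longrightarrow> (v, u) \<in> mon_cong X R"
| mc_trans: "(u, v) \<in> mon_cong X R \<Longrightarrow> (v, w) \<in> mon_cong X R \<Longrightarrow> (u, w) \<in> mon_cong X R"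
| mc_append: "(u, u') \<in> mon_cong X R \<Longrightarrow> (v, v') \<in> mon_cong X R
    \<Longrightarrow> (u @ v, u' @ v') \<in> mon_cong X R"

definition word_class :: "'a set \<Rightarrow> ('a list \<times> 'a list) set \<Rightarrow> 'a list \<Rightarrow> 'a list set" where
  "word_class X R w = mon_cong X R `` {w}"

definition monoid_pres :: "'a set \<Rightarrow> ('a list \<times> 'a list) set \<Rightarrow> 'a list set monoid" where
  "monoid_pres X R = \<lparr>
     carrier = lists X // mon_cong X R,
     mult = (\<lambda>A B. \<Union>u\<in>A. \<Union>v\<in>B. word_class X R (u @ v)),
     one = word_class X R [] \<rparr>"

text \<open>
  Letters of group words are \<open>Inl x\<close> (the generator \<open>x\<close>) and \<open>Inr x\<close> (its formal inverse).
\<close>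

definition cancel_rels :: "'a set \<Rightarrow> (('a + 'a) list \<times> ('a + 'a) list) set" where
  "cancel_rels X = (\<Union>x\<in>X. {([Inl x, Inr x], []), ([Inr x, Inl x], [])})"

definition group_pres ::
    "'a set \<Rightarrow> (('a + 'a) list \<times> ('a + 'a) list) set \<Rightarrow> ('a + 'a) list set monoid" where
  "group_pres X R = monoid_pres (X <+> X) (cancel_rels X \<union> R)"

definition semiregular :: "nat \<Rightarrow> (nat \<Rightarrow> nat) set \<Rightarrow> bool" where
  "semiregular n H \<longleftrightarrow> (\<forall>i\<in>{1..n}. {\<sigma> \<in> H. \<sigma> i = i} = {id})"

definition S_rels :: "nat \<Rightarrow> nat \<Rightarrow> (nat \<Rightarrow> nat) set \<Rightarrow> (nat list \<times> nat list) set" where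
  "S_rels n l H = {(w, map \<sigma> w) | w \<sigma>. w \<in> lists {1..n} \<and> length w = l \<and> \<sigma> \<in> H}"

definition S_monoid :: "nat \<Rightarrow> nat \<Rightarrow> (nat \<Rightarrow> nat) set \<Rightarrow> nat list set monoid" where
  "S_monoid n l H = monoid_pres {1..n} (S_rels n l H)"

definition G_rels ::
    "nat \<Rightarrow> nat \<Rightarrow> (nat \<Rightarrow> nat) set \<Rightarrow> ((nat + nat) list \<times> (nat + nat) list) set" where
  "G_rels n l H = map_prod (map Inl) (map Inl) ` S_rels n l H"

definition G_group :: "nat \<Rightarrow> nat \<Rightarrow> (nat \<Rightarrow> nat) set \<Rightarrow> (nat + nat) list set monoid" where
  "G_group n l H = group_pres {1..n} (G_rels n l H)"

definition S_gen :: "nat \<Rightarrow> nat \<Rightarrow> (nat \<Rightarrow> nat) set \<Rightarrow> nat \<Rightarrow> nat list set" where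
  "S_gen n l H i = word_class {1..n} (S_rels n l H) [i]"

definition G_class :: "nat \<Rightarrow> nat \<Rightarrow> (nat \<Rightarrow> nat) set \<Rightarrow> (nat + nat) list \<Rightarrow> (nat + nat) list set" where
  "G_class n l H = word_class ({1..n} <+> {1..n}) (cancel_rels {1..n} \<union> G_rels n l H)"

definition G_gen :: "nat \<Rightarrow> nat \<Rightarrow> (nat \<Rightarrow> nat) set \<Rightarrow> nat \<Rightarrow> (nat + nat) list set" where
  "G_gen n l H i = G_class n l H [Inl i]"

text \<open>
  The class of \<open>w\<close> is sent to the class of \<open>w\<close> read as a positive group word; the union is over
  equal sets, by \<open>natural_map_class\<close> below.
\<close>

definition natural_map ::
    "nat \<Rightarrow> nat \<Rightarrow> (nat \<Rightarrow> nat) set \<Rightarrow> nat list set \<Rightarrow> (nat + nat) list set" where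
  "natural_map n l H A = (\<Union>w\<in>A. G_class n l H (map Inl w))"

lemma mon_cong_lists:
  "(u, v) \<in> mon_cong X R \<Longrightarrow> u \<in> lists X \<and> v \<in> lists X"
  by (induction rule: mon_cong.induct) auto

lemma equiv_mon_cong: "equiv (lists X) (mon_cong X R)"
proof (rule equivI)
  show "mon_cong X R \<subseteq> lists X \<times> lists X" using mon_cong_lists by fastforce
  show "refl_on (lists X) (mon_cong X R)"
    by (rule refl_onI) (rule mc_refl)
  show "sym (mon_cong X R)" by (rule symI) (rule mc_sym)
  show "trans (mon_cong X R)" by (rule transI) (rule mc_trans)
qed

lemma word_class_eq_iff:
  "u \<in> lists X \<Longrightarrow> v \<in> lists X \<Longrightarrow> word_class X R u = word_class X R v \<longleftrightarrow> (u, v) \<in> mon_cong X R"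
  unfolding word_class_def by (rule eq_equiv_class_iff[OF equiv_mon_cong])

lemma word_class_self: "w \<in> lists X \<Longrightarrow> w \<in> word_class X R w"
  unfolding word_class_def by (simp add: mc_refl)

lemma carrier_monoid_pres: "carrier (monoid_pres X R) = word_class X R ` lists X"
  unfolding monoid_pres_def quotient_def word_class_def by auto

lemma one_monoid_pres: "\<one>\<^bsub>monoid_pres X R\<^esub> = word_class X R []"
  by (simp add: monoid_pres_def)

lemma UN_eq_const: "x \<in> A \<Longrightarrow> (\<And>y. y \<in> A \<Longrightarrow> f y = c) \<Longrightarrow> (\<Union>y\<in>A. f y) = c"
  by auto

lemma mult_monoid_pres:
  assumes "u \<in> lists X" "v \<in> lists X"
  shows "word_class X R u \<otimes>\<^bsub>monoid_pres X R\<^esub> word_class X R v = word_class X R (u @ v)"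
proof -
  have "word_class X R (u' @ v') = word_class X R (u @ v)"
    if "u' \<in> word_class X R u" "v' \<in> word_class X R v" for u' v'
  proof -
    have "(u, u') \<in> mon_cong X R" "(v, v') \<in> mon_cong X R"
      using that by (auto simp: word_class_def)
    then have c: "(u @ v, u' @ v') \<in> mon_cong X R" by (rule mc_append)
    show ?thesis
      by (rule word_class_eq_iff[THEN iffD2, OF _ _ mc_sym[OF c]])
        (use mon_cong_lists[OF c] in blast)+
  qed
  then have "(\<Union>u'\<in>word_class X R u. \<Union>v'\<in>word_class X R v. word_class X R (u' @ v'))
      = word_class X R (u @ v)"
    by - (rule UN_eq_const[OF word_class_self[OF assms(1)]],
        rule UN_eq_const[OF word_class_self[OF assms(2)]])
  then show ?thesis unfolding monoid_pres_def by (simp only: monoid.select_convs)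
qed

lemma monoid_monoid_pres: "monoid (monoid_pres X R)"
proof (rule monoidI)
  fix a b assume "a \<in> carrier (monoid_pres X R)" "b \<in> carrier (monoid_pres X R)"
  then obtain u v where m: "u \<in> lists X" "v \<in> lists X"
    and e: "a = word_class X R u" "b = word_class X R v"
    by (auto simp: carrier_monoid_pres)
  then show "a \<otimes>\<^bsub>monoid_pres X R\<^esub> b \<in> carrier (monoid_pres X R)"
    unfolding e mult_monoid_pres[OF m] carrier_monoid_pres using m
    by (intro imageI) simp
next
  show "\<one>\<^bsub>monoid_pres X R\<^esub> \<in> carrier (monoid_pres X R)"
    by (auto simp: carrier_monoid_pres one_monoid_pres)
next
  fix a b c
  assume "a \<in> carrier (monoid_pres X R)" "b \<in> carrier (monoid_pres X R)"
    "c \<in> carrier (monoid_pres X R)"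
  then obtain u v w where m: "u \<in> lists X" "v \<in> lists X" "w \<in> lists X"
    and e: "a = word_class X R u" "b = word_class X R v" "c = word_class X R w"
    by (auto simp: carrier_monoid_pres)
  have uv: "u @ v \<in> lists X" "v @ w \<in> lists X" using m by auto
  show "a \<otimes>\<^bsub>monoid_pres X R\<^esub> b \<otimes>\<^bsub>monoid_pres X R\<^esub> c
      = a \<otimes>\<^bsub>monoid_pres X R\<^esub> (b \<otimes>\<^bsub>monoid_pres X R\<^esub> c)"
    unfolding e mult_monoid_pres[OF m(1,2)] mult_monoid_pres[OF m(2,3)]
      mult_monoid_pres[OF uv(1) m(3)] mult_monoid_pres[OF m(1) uv(2)] append_assoc ..
next
  fix a assume "a \<in> carrier (monoid_pres X R)"
  then obtain u where u: "u \<in> lists X" "a = word_class X R u"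
    by (auto simp: carrier_monoid_pres)
  show "\<one>\<^bsub>monoid_pres X R\<^esub> \<otimes>\<^bsub>monoid_pres X R\<^esub> a = a"
    unfolding u(2) one_monoid_pres mult_monoid_pres[OF lists.Nil u(1)] by (simp only: append_Nil)
  show "a \<otimes>\<^bsub>monoid_pres X R\<^esub> \<one>\<^bsub>monoid_pres X R\<^esub> = a"
    unfolding u(2) one_monoid_pres mult_monoid_pres[OF u(1) lists.Nil] by (simp only: append_Nil2)
qed

lemma group_group_pres: "group (group_pres X R)"
proof -
  define Y Q where "Y = X <+> X" and "Q = cancel_rels X \<union> R"
  interpret monoid "monoid_pres Y Q" by (rule monoid_monoid_pres)
  have inv: "\<exists>v\<in>lists Y. (v @ u, []) \<in> mon_cong Y Q" if "u \<in> lists Y" for u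
    using that
  proof (induction u)
    case Nil
    show ?case by (rule bexI[of _ "[]"]) (auto intro: mc_refl)
  next
    case (Cons a u)
    obtain v where v: "v \<in> lists Y" "(v @ u, []) \<in> mon_cong Y Q" using Cons.IH by blast
    have "\<exists>b\<in>Y. ([b, a], []) \<in> Q"
    proof (cases a)
      case (Inl x)
      have "x \<in> X" using Inl Cons.hyps by (auto simp: Y_def)
      then show ?thesis unfolding Y_def Q_def cancel_rels_def
        by (intro bexI[of _ "Inr x"]) (auto simp: Inl)
    next
      case (Inr x)
      have "x \<in> X" using Inr Cons.hyps by (auto simp: Y_def)
      then show ?thesis unfolding Y_def Q_def cancel_rels_def
        by (intro bexI[of _ "Inl x"]) (auto simp: Inr)
    qed
    then obtain b where b: "b \<in> Y" "([b, a], []) \<in> Q" by blast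
    have "([b, a], []) \<in> mon_cong Y Q"
      using b Cons.hyps by (intro mc_rel) auto
    then have "(v @ ([b, a] @ u), v @ ([] @ u)) \<in> mon_cong Y Q"
      using v(1) Cons.hyps by (intro mc_append) (auto intro: mc_refl)
    then have "((v @ [b]) @ (a # u), []) \<in> mon_cong Y Q"
      using mc_trans[OF _ v(2)] by simp
    moreover have "v @ [b] \<in> lists Y" using v b by simp
    ultimately show ?case by blast
  qed
  have "group (monoid_pres Y Q)"
  proof (rule groupI)
    fix a assume "a \<in> carrier (monoid_pres Y Q)"
    then obtain u where u: "u \<in> lists Y" "a = word_class Y Q u"
      by (auto simp: carrier_monoid_pres)
    obtain v where v: "v \<in> lists Y" "(v @ u, []) \<in> mon_cong Y Q" using inv[OF u(1)] by blast
    have "word_class Y Q v \<otimes>\<^bsub>monoid_pres Y Q\<^esub> a = \<one>\<^bsub>monoid_pres Y Q\<^esub>"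
      unfolding u(2) one_monoid_pres mult_monoid_pres[OF v(1) u(1)]
      by (rule word_class_eq_iff[THEN iffD2, OF _ _ v(2)]) (simp_all add: v u)
    moreover have "word_class Y Q v \<in> carrier (monoid_pres Y Q)"
      unfolding carrier_monoid_pres using v(1) by (rule imageI)
    ultimately show "\<exists>y\<in>carrier (monoid_pres Y Q). y \<otimes>\<^bsub>monoid_pres Y Q\<^esub> a = \<one>\<^bsub>monoid_pres Y Q\<^esub>"
      by (rule bexI)
  qed (simp_all add: m_assoc)
  then show ?thesis unfolding group_pres_def Y_def Q_def .
qed

lemma monoid_S: "monoid (S_monoid n l H)"
  unfolding S_monoid_def by (rule monoid_monoid_pres)

lemma group_G: "group (G_group n l H)"
  unfolding G_group_def by (rule group_group_pres)

lemma map_Inl_lists: "w \<in> lists X \<Longrightarrow> map Inl w \<in> lists (X <+> X)"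
  by (induction w) auto

lemma mon_cong_S_imp_G:
  assumes "(u, v) \<in> mon_cong {1..n} (S_rels n l H)"
  shows "(map Inl u, map Inl v)
    \<in> mon_cong ({1..n} <+> {1..n}) (cancel_rels {1..n} \<union> G_rels n l H)"
  using assms
proof (induction rule: mon_cong.induct)
  case (mc_refl w)
  then show ?case by (intro mon_cong.mc_refl map_Inl_lists)
next
  case (mc_rel u v)
  have "(map Inl u, map Inl v) \<in> cancel_rels {1..n} \<union> G_rels n l H"
    using mc_rel(1) unfolding G_rels_def by force
  then show ?case using mc_rel by (intro mon_cong.mc_rel map_Inl_lists)
next
  case (mc_append u u' v v')
  then show ?case by (simp add: mon_cong.mc_append)
qed (auto intro: mon_cong.mc_sym mon_cong.mc_trans)

lemma natural_map_class:
  assumes "w \<in> lists {1..n}"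
  shows "natural_map n l H (word_class {1..n} (S_rels n l H) w) = G_class n l H (map Inl w)"
proof -
  have "G_class n l H (map Inl v) = G_class n l H (map Inl w)"
    if "v \<in> word_class {1..n} (S_rels n l H) w" for v
  proof -
    have "(w, v) \<in> mon_cong {1..n} (S_rels n l H)"
      using that by (simp add: word_class_def)
    then have c: "(map Inl w, map Inl v)
        \<in> mon_cong ({1..n} <+> {1..n}) (cancel_rels {1..n} \<union> G_rels n l H)"
      by (rule mon_cong_S_imp_G)
    show ?thesis
      unfolding G_class_def using word_class_eq_iff[THEN iffD2, OF _ _ c] mon_cong_lists[OF c]
      by simp
  qed
  then show ?thesis
    unfolding natural_map_def by (rule UN_eq_const[OF word_class_self[OF assms]])
qed

lemma natural_map_gen: "i \<in> {1..n} \<Longrightarrow> natural_map n l H (S_gen n l H i) = G_gen n l H i"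
  unfolding S_gen_def G_gen_def by (subst natural_map_class) auto

lemma natural_map_hom: "natural_map n l H \<in> hom (S_monoid n l H) (G_group n l H)"
proof (rule homI)
  fix a assume "a \<in> carrier (S_monoid n l H)"
  then obtain u where u: "u \<in> lists {1..n}" "a = word_class {1..n} (S_rels n l H) u"
    by (auto simp: S_monoid_def carrier_monoid_pres)
  show "natural_map n l H a \<in> carrier (G_group n l H)"
    unfolding u(2) natural_map_class[OF u(1)]
    unfolding G_group_def group_pres_def carrier_monoid_pres G_class_def
    using map_Inl_lists[OF u(1)] by (rule imageI)
next
  fix a b assume "a \<in> carrier (S_monoid n l H)" "b \<in> carrier (S_monoid n l H)"
  then obtain u v where u: "u \<in> lists {1..n}" "a = word_class {1..n} (S_rels n l H) u"
    and v: "v \<in> lists {1..n}" "b = word_class {1..n} (S_rels n l H) v"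
    by (auto simp: S_monoid_def carrier_monoid_pres)
  have uv: "u @ v \<in> lists {1..n}" using u v by simp
  show "natural_map n l H (a \<otimes>\<^bsub>S_monoid n l H\<^esub> b)
      = natural_map n l H a \<otimes>\<^bsub>G_group n l H\<^esub> natural_map n l H b"
    unfolding u(2) v(2) S_monoid_def mult_monoid_pres[OF u(1) v(1)]
      natural_map_class[OF u(1)] natural_map_class[OF v(1)] natural_map_class[OF uv]
    unfolding G_group_def group_pres_def G_class_def
      mult_monoid_pres[OF map_Inl_lists[OF u(1)] map_Inl_lists[OF v(1)]] map_append ..
qed

lemma natural_map_one: "natural_map n l H \<one>\<^bsub>S_monoid n l H\<^esub> = \<one>\<^bsub>G_group n l H\<^esub>"
  unfolding S_monoid_def G_group_def group_pres_def one_monoid_pres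
  by (subst natural_map_class) (auto simp: G_class_def)

end

theory Submission
  imports Defs HOL.Rat
begin

text \<open>
  Since \<open>H\<close> is semi-regular, every letter \<open>i\<close> is \<open>\<tau> (r)\<close> for the chosen representative
  \<open>r = rep i\<close> of its orbit and exactly one \<open>\<tau> = coord i\<close> in \<open>H\<close>, and \<open>\<sigma> \<in> H\<close> acts on letters by
  \<open>coord (\<sigma> i) = \<sigma> \<circ> coord i\<close>.  So a word of length \<open>m\<close> is a word of orbits together with an
  element of \<open>H\<^sup>m\<close>, and a defining relation leaves the orbits alone and multiplies \<open>l\<close> consecutive
  coordinates by the same \<open>\<sigma>\<close>.  As \<open>H\<close> is abelian, the \<open>l\<close> products of the coordinates over the
  positions in one residue class modulo \<open>l\<close>, taken in \<open>H\<^sup>l\<close> modulo its diagonal, are invariant.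

  Two facts give the embedding.

  The word of orbits and the class in \<open>H\<^sup>l\<close> modulo the diagonal determine a positive word
  up to the congruence of the monoid (\<open>mon_cong_if_invariants_eq\<close>).  If the first letters of two
  words of length at least \<open>l\<close> lie in one orbit, a relation applied to the first window of one word
  makes these letters equal, and one continues with the tails.  In a word with fewer than \<open>l\<close>
  letters some residue class is empty; this pins down the diagonal factor, and every coordinate can
  be read off.

  Both invariants are visible in the universal group, because they come from actions by bijections.
  The word of orbits is recorded by affine maps of the rationals: appending a digit to a numeral
  in base \<open>n + 1\<close> is an invertible affine map, and a numeral with no digit zero determines
  its digits (\<open>affine_invariant\<close>, \<open>affine_positive_inject\<close>).  The products are recorded by a
  register of \<open>l\<close> elements of \<open>H\<close> on which a letter multiplies the head and moves it to the end, so
  that the position modulo \<open>l\<close> is kept by the rotation; it is well defined up to a common factor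
  (\<open>rotor_invariant\<close>).  In other words, the group maps to
  the direct product of an affine group and \<open>(H\<^sup>l / H) \<rtimes> \<int>\<close>.
\<close>

section \<open>Coordinates for a semi-regular abelian permutation group\<close>

locale semiregular_abelian =
  fixes n :: nat and H :: "(nat \<Rightarrow> nat) set"
  assumes subgroup: "subgroup H (sym_group n)"
    and abelian: "comm_group (sym_group n \<lparr>carrier := H\<rparr>)"
    and semireg: "semiregular n H"
begin

lemma permutes: "\<sigma> \<in> H \<Longrightarrow> \<sigma> permutes {1..n}"
  using subgroup.subset[OF subgroup] by (auto simp: sym_group_carrier)

lemma id_in: "id \<in> H"
  using subgroup.one_closed[OF subgroup] by (simp add: sym_group_def)

lemma comp_in: "\<sigma> \<in> H \<Longrightarrow> \<rho> \<in> H \<Longrightarrow> \<sigma> \<circ> \<rho> \<in> H"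
  using subgroup.m_closed[OF subgroup, of \<sigma> \<rho>] by (simp add: sym_group_def)

lemma inv_in: "\<sigma> \<in> H \<Longrightarrow> inv' \<sigma> \<in> H"
  using subgroup.m_inv_closed[OF subgroup, of \<sigma>] permutes
  by (simp add: sym_group_inv_equality sym_group_carrier)

lemma comp_commute: "\<sigma> \<in> H \<Longrightarrow> \<rho> \<in> H \<Longrightarrow> \<sigma> \<circ> \<rho> = \<rho> \<circ> \<sigma>"
  using comm_monoid.m_comm[OF comm_group.axioms(1)[OF abelian], of \<sigma> \<rho>]
  by (simp add: sym_group_def)

lemma inv_comp: "\<sigma> \<in> H \<Longrightarrow> inv' \<sigma> \<circ> \<sigma> = id" "\<sigma> \<in> H \<Longrightarrow> \<sigma> \<circ> inv' \<sigma> = id"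
  using permutes_inv_o[OF permutes] by auto

lemma inv_comp_app: "\<sigma> \<in> H \<Longrightarrow> inv' \<sigma> (\<sigma> i) = i" "\<sigma> \<in> H \<Longrightarrow> \<sigma> (inv' \<sigma> i) = i"
  using permutes_inverses[OF permutes] by auto

lemma comp_right_cancel: "g \<in> H \<Longrightarrow> \<sigma> \<circ> g = \<rho> \<circ> g \<longleftrightarrow> \<sigma> = \<rho>"
  by (metis comp_assoc comp_id inv_comp(2))

lemma app_in: "\<sigma> \<in> H \<Longrightarrow> i \<in> {1..n} \<Longrightarrow> \<sigma> i \<in> {1..n}"
  using permutes_in_image[OF permutes] by blast

lemma map_in_lists: "\<sigma> \<in> H \<Longrightarrow> w \<in> lists {1..n} \<Longrightarrow> map \<sigma> w \<in> lists {1..n}"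
  using app_in by (induction w) auto

text \<open>
  Semi-regularity turns equality of permutations into equality at a single point, which makes
  the coordinate of a letter unique.
\<close>

lemma agree_imp_eq:
  assumes "\<sigma> \<in> H" "\<rho> \<in> H" "i \<in> {1..n}" "\<sigma> i = \<rho> i"
  shows "\<sigma> = \<rho>"
proof -
  have "inv' \<rho> \<circ> \<sigma> \<in> {\<tau> \<in> H. \<tau> i = i}"
    using assms by (simp add: comp_in inv_in inv_comp_app)
  then have "inv' \<rho> \<circ> \<sigma> = id" using semireg assms(3) unfolding semiregular_def by blast
  then have "\<rho> \<circ> (inv' \<rho> \<circ> \<sigma>) = \<rho>" by simp
  then show ?thesis using inv_comp(2)[OF assms(2)] by (simp add: comp_assoc[symmetric])
qed

definition rep :: "nat \<Rightarrow> nat" where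
  "rep i = (LEAST j. \<exists>\<sigma>\<in>H. \<sigma> i = j)"

definition coord :: "nat \<Rightarrow> nat \<Rightarrow> nat" where
  "coord i = (SOME \<sigma>. \<sigma> \<in> H \<and> \<sigma> (rep i) = i)"

lemma rep_orbit: "\<exists>\<sigma>\<in>H. \<sigma> i = rep i"
  unfolding rep_def by (rule LeastI_ex) (use id_in in blast)

lemma rep_in: "i \<in> {1..n} \<Longrightarrow> rep i \<in> {1..n}"
  using rep_orbit[of i] app_in by metis

lemma rep_app: "\<sigma> \<in> H \<Longrightarrow> rep (\<sigma> i) = rep i"
proof -
  assume \<sigma>: "\<sigma> \<in> H"
  have "(\<exists>\<rho>\<in>H. \<rho> (\<sigma> i) = j) \<longleftrightarrow> (\<exists>\<rho>\<in>H. \<rho> i = j)" for j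
  proof
    assume "\<exists>\<rho>\<in>H. \<rho> (\<sigma> i) = j"
    then obtain \<rho> where "\<rho> \<in> H" "(\<rho> \<circ> \<sigma>) i = j" by auto
    with comp_in[OF _ \<sigma>] show "\<exists>\<rho>\<in>H. \<rho> i = j" by blast
  next
    assume "\<exists>\<rho>\<in>H. \<rho> i = j"
    then obtain \<rho> where "\<rho> \<in> H" "(\<rho> \<circ> inv' \<sigma>) (\<sigma> i) = j" by (auto simp: inv_comp_app \<sigma>)
    with comp_in[OF _ inv_in[OF \<sigma>]] show "\<exists>\<rho>\<in>H. \<rho> (\<sigma> i) = j" by blast
  qed
  then show ?thesis unfolding rep_def by simp
qed

lemma coord_in: "coord i \<in> H" and coord_rep: "coord i (rep i) = i"
proof -
  obtain \<sigma> where "\<sigma> \<in> H" "\<sigma> i = rep i" using rep_orbit by blast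
  then have "inv' \<sigma> \<in> H \<and> inv' \<sigma> (rep i) = i" using inv_in inv_comp_app by metis
  then have "coord i \<in> H \<and> coord i (rep i) = i" unfolding coord_def by (rule someI[where P = "\<lambda>\<sigma>. \<sigma> \<in> H \<and> \<sigma> (rep i) = i"])
  then show "coord i \<in> H" "coord i (rep i) = i" by auto
qed

lemma coord_app:
  assumes "\<sigma> \<in> H" "i \<in> {1..n}"
  shows "coord (\<sigma> i) = \<sigma> \<circ> coord i"
proof (rule agree_imp_eq[OF coord_in comp_in[OF assms(1) coord_in] rep_in[OF assms(2)]])
  show "coord (\<sigma> i) (rep i) = (\<sigma> \<circ> coord i) (rep i)"
    using coord_rep[of "\<sigma> i"] coord_rep[of i] rep_app[OF assms(1)] by simp
qed

lemma coord_rep_inject: "coord i = coord j \<Longrightarrow> rep i = rep j \<Longrightarrow> i = j"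
  using coord_rep by metis

section \<open>The word of orbits\<close>

text \<open>
  The orbits are written as digits in base \<open>n + 1\<close>.  The inverse letter has to act as a total
  inverse of the map \<open>y \<mapsto> (n + 1) y + d\<close>, hence the rationals instead of the naturals.
\<close>

fun affine :: "nat + nat \<Rightarrow> rat \<Rightarrow> rat" where
  "affine (Inl i) y = y * of_nat (Suc n) + of_nat (rep i)"
| "affine (Inr i) y = (y - of_nat (rep i)) / of_nat (Suc n)"

lemma affine_cancel: "affine (Inr i) (affine (Inl i) y) = y" "affine (Inl i) (affine (Inr i) y) = y"
  by (simp_all add: field_simps del: of_nat_Suc)

lemma fold_affine_twist: "\<sigma> \<in> H \<Longrightarrow> fold affine (map Inl (map \<sigma> w)) = fold affine (map Inl w)"
proof (induction w)
  case (Cons i w)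
  have "affine (Inl (\<sigma> i)) = affine (Inl i)" using rep_app[OF Cons.prems] by auto
  then show ?case using Cons by simp
qed simp

lemma affine_invariant:
  assumes "(u, v) \<in> mon_cong ({1..n} <+> {1..n}) (cancel_rels {1..n} \<union> G_rels n l H)"
  shows "fold affine u = fold affine v"
  using assms
proof (induction rule: mon_cong.induct)
  case (mc_rel u v)
  then consider "(u, v) \<in> cancel_rels {1..n}" | "(u, v) \<in> G_rels n l H" by blast
  then show ?case
  proof cases
    case 1
    then show ?thesis by (auto simp: cancel_rels_def fun_eq_iff affine_cancel simp del: affine.simps)
  next
    case 2
    then show ?thesis using fold_affine_twist by (auto simp: G_rels_def S_rels_def simp del: map_map)
  qed
qed auto

text \<open>
  A positive word sends zero to the numeral whose digits are its orbit representatives.  These lie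
  between \<open>1\<close> and \<open>n\<close>: being smaller than the base they can be read off one by one, and
  being nonzero they also determine the length.
\<close>

lemma affine_positive_inject:
  assumes "u \<in> lists {1..n}" "v \<in> lists {1..n}"
    and "fold affine (map Inl u) 0 = fold affine (map Inl v) 0"
  shows "map rep u = map rep v"
proof -
  define val where "val w = fold (\<lambda>i y. y * Suc n + rep i) w 0" for w
  have val_snoc: "val (w @ [i]) = val w * Suc n + rep i" for w i by (simp add: val_def)
  have val_Nil: "val [] = 0" by (simp add: val_def)
  have digit: "0 < rep i \<and> rep i < Suc n" if "i \<in> {1..n}" for i using rep_in[OF that] by auto
  have val_rat: "fold affine (map Inl w) 0 = of_nat (val w)" for w
  proof (induction w rule: rev_induct)
    case Nil
    show ?case by (simp add: val_Nil)
  next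
    case (snoc i w)
    show ?case
      by (simp only: map_append list.map fold_append comp_apply fold_simps affine.simps snoc.IH
          val_snoc of_nat_add of_nat_mult)
  qed
  (* The numerals are compared as natural numbers, where the last digit is the remainder. *)
  have "map rep u = map rep v"
    if "u \<in> lists {1..n}" "v \<in> lists {1..n}" "val u = val v" for u v
    using that
  proof (induction u arbitrary: v rule: rev_induct)
    case Nil
    show ?case
    proof (cases v rule: rev_cases)
      case v: (snoc w b)
      then show ?thesis using Nil.prems digit[of b] by (simp add: val_Nil val_snoc)
    qed simp
  next
    case (snoc a u)
    show ?case
    proof (cases v rule: rev_cases)
      case Nil
      then show ?thesis using snoc.prems digit[of a] by (simp add: val_Nil val_snoc)
    next
      case v: (snoc w b)
      have e: "val u * Suc n + rep a = val w * Suc n + rep b"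
        using snoc.prems(3) unfolding v val_snoc .
      have ab: "rep a < Suc n" "rep b < Suc n" using digit snoc.prems(1,2) v by auto
      have "rep a = rep b"
        using arg_cong[OF e, of "\<lambda>x. x mod Suc n"] ab by (simp only: mod_mult_self3 mod_less)
      moreover from this have "val u = val w"
        using e by (simp only: add_right_cancel mult_cancel2) simp
      ultimately show ?thesis using snoc.IH[of w] snoc.prems(1,2) unfolding v by simp
    qed
  qed
  then show ?thesis using assms(1,2) assms(3)[unfolded val_rat of_nat_eq_iff] by blast
qed

section \<open>The rotating register\<close>

text \<open>
  The head of the register is the product for the residue class of the current position.
\<close>

fun rotor :: "nat + nat \<Rightarrow> (nat \<Rightarrow> nat) list \<Rightarrow> (nat \<Rightarrow> nat) list" where
  "rotor (Inl i) fs = tl fs @ [coord i \<circ> hd fs]"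
| "rotor (Inr i) fs = (inv' (coord i) \<circ> last fs) # butlast fs"

text \<open>
  Registers are to be compared modulo the diagonal of \<open>H\<^sup>l\<close>, whose action this is.
\<close>

abbreviation twist :: "(nat \<Rightarrow> nat) \<Rightarrow> (nat \<Rightarrow> nat) list \<Rightarrow> (nat \<Rightarrow> nat) list" where
  "twist \<sigma> \<equiv> map ((\<circ>) \<sigma>)"

lemma twist_twist: "twist \<sigma> (twist \<rho> fs) = twist (\<sigma> \<circ> \<rho>) fs"
  by (simp add: comp_assoc)

lemma twist_id: "twist id fs = fs"
  by (simp add: map_idI)

lemma twist_inverse: "\<sigma> \<in> H \<Longrightarrow> fs = twist \<sigma> gs \<Longrightarrow> gs = twist (inv' \<sigma>) fs"
  by (simp only: twist_twist inv_comp twist_id)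

definition registers :: "nat \<Rightarrow> (nat \<Rightarrow> nat) list set" where
  "registers l = {fs \<in> lists H. length fs = l}"

lemma rotor_registers:
  assumes "0 < l" "fs \<in> registers l"
  shows "rotor a fs \<in> registers l"
proof -
  have "fs \<noteq> []" using assms by (auto simp: registers_def)
  then show ?thesis using assms coord_in inv_in comp_in
    by (cases a) (auto simp: registers_def dest: in_set_butlastD list.set_sel)
qed

lemma fold_rotor_registers: "0 < l \<Longrightarrow> fs \<in> registers l \<Longrightarrow> fold rotor w fs \<in> registers l"
  by (induction w arbitrary: fs) (auto simp: rotor_registers simp del: rotor.simps)

lemma rotor_cancel:
  assumes "fs \<noteq> []"
  shows "rotor (Inr i) (rotor (Inl i) fs) = fs" "rotor (Inl i) (rotor (Inr i) fs) = fs"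
  using assms inv_comp[OF coord_in] by (simp_all add: comp_assoc[symmetric])

text \<open>
  Here commutativity enters: it makes the action descend to registers modulo the diagonal.
\<close>

lemma rotor_twist:
  assumes "\<sigma> \<in> H" "fs \<noteq> []"
  shows "rotor a (twist \<sigma> fs) = twist \<sigma> (rotor a fs)"
proof -
  have "coord i \<circ> (\<sigma> \<circ> f) = \<sigma> \<circ> (coord i \<circ> f)"
    "inv' (coord i) \<circ> (\<sigma> \<circ> f) = \<sigma> \<circ> (inv' (coord i) \<circ> f)" for i f
    using comp_commute[OF assms(1)] coord_in inv_in by (metis comp_assoc)+
  then show ?thesis using assms(2)
    by (cases a) (simp_all add: map_tl hd_map last_map map_butlast)
qed

lemma fold_rotor_twist:
  assumes "\<sigma> \<in> H" "0 < l" "fs \<in> registers l"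
  shows "fold rotor w (twist \<sigma> fs) = twist \<sigma> (fold rotor w fs)"
  using assms(3)
proof (induction w arbitrary: fs)
  case (Cons a w)
  have "fs \<noteq> []" using Cons.prems assms(2) by (auto simp: registers_def)
  then show ?case
    using Cons.IH[OF rotor_registers[OF assms(2) Cons.prems]]
    by (simp only: fold_simps rotor_twist[OF assms(1) \<open>fs \<noteq> []\<close>])
qed simp

text \<open>
  Within one turn of the register no entry is met twice, so the products have a single factor.
\<close>

lemma fold_rotor_positive:
  "length w = length fs \<Longrightarrow>
    fold rotor (map Inl w) (fs @ gs) = gs @ map2 (\<lambda>i f. coord i \<circ> f) w fs"
  by (induction w fs arbitrary: gs rule: list_induct2) auto

text \<open>
  A window that fills the register meets every residue class exactly once, so moving it by \<open>\<sigma>\<close>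
  changes the register by the diagonal element \<open>\<sigma>\<close>.
\<close>

lemma fold_rotor_window:
  assumes "\<sigma> \<in> H" "w \<in> lists {1..n}" "length w = length fs"
  shows "fold rotor (map Inl (map \<sigma> w)) fs = twist \<sigma> (fold rotor (map Inl w) fs)"
proof -
  have "map2 (\<lambda>i f. coord i \<circ> f) (map \<sigma> w) fs = twist \<sigma> (map2 (\<lambda>i f. coord i \<circ> f) w fs)"
    using assms(3,2)
    by (induction w fs rule: list_induct2) (auto simp: coord_app[OF assms(1)] comp_assoc)
  then show ?thesis
    using fold_rotor_positive[of w fs "[]"] fold_rotor_positive[of "map \<sigma> w" fs "[]"] assms(3)
    by simp
qed

text \<open>
  The register is arbitrary because in a product of two words the second one acts on
  whatever the first one leaves behind.
\<close>

lemma rotor_invariant: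
  assumes "(u, v) \<in> mon_cong ({1..n} <+> {1..n}) (cancel_rels {1..n} \<union> G_rels n l H)"
    and "0 < l" "fs \<in> registers l"
  shows "\<exists>\<sigma>\<in>H. fold rotor u fs = twist \<sigma> (fold rotor v fs)"
  using assms(1,3)
proof (induction arbitrary: fs rule: mon_cong.induct)
  case (mc_refl w)
  show ?case using id_in by (intro bexI[of _ id]) (simp_all only: twist_id)
next
  case (mc_rel u v)
  then consider "(u, v) \<in> cancel_rels {1..n}" | "(u, v) \<in> G_rels n l H" by blast
  then show ?case
  proof cases
    case 1
    have "fs \<noteq> []" using mc_rel.prems assms(2) by (auto simp: registers_def)
    then have "fold rotor u fs = twist id (fold rotor v fs)"
      unfolding twist_id using 1
      by (auto simp: cancel_rels_def rotor_cancel simp del: rotor.simps)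
    then show ?thesis using id_in by blast
  next
    case 2
    then obtain w \<sigma> where w: "w \<in> lists {1..n}" "length w = l" and \<sigma>: "\<sigma> \<in> H"
      and uv: "u = map Inl w" "v = map Inl (map \<sigma> w)"
      by (auto simp: G_rels_def S_rels_def simp del: map_map)
    have "fold rotor v fs = twist \<sigma> (fold rotor u fs)"
      unfolding uv using \<sigma> w mc_rel.prems by (intro fold_rotor_window) (auto simp: registers_def)
    then show ?thesis using twist_inverse[OF \<sigma>] inv_in[OF \<sigma>] by blast
  qed
next
  case (mc_sym u v)
  then obtain \<sigma> where \<sigma>: "\<sigma> \<in> H" "fold rotor u fs = twist \<sigma> (fold rotor v fs)" by blast
  then show ?case using twist_inverse[OF \<sigma>] inv_in by blast
next
  case (mc_trans u v w)
  then obtain \<sigma> \<rho> where "\<sigma> \<in> H" "\<rho> \<in> H" "fold rotor u fs = twist \<sigma> (fold rotor v fs)"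
    "fold rotor v fs = twist \<rho> (fold rotor w fs)" by blast
  then show ?case using comp_in twist_twist by metis
next
  case (mc_append u u' v v')
  obtain \<sigma> where \<sigma>: "\<sigma> \<in> H" "fold rotor u fs = twist \<sigma> (fold rotor u' fs)"
    using mc_append by blast
  have r: "fold rotor u' fs \<in> registers l"
    using fold_rotor_registers[OF assms(2) mc_append.prems] .
  then obtain \<rho> where \<rho>: "\<rho> \<in> H"
    "fold rotor v (fold rotor u' fs) = twist \<rho> (fold rotor v' (fold rotor u' fs))"
    using mc_append by blast
  have "fold rotor (u @ v) fs = twist (\<sigma> \<circ> \<rho>) (fold rotor (u' @ v') fs)"
    using fold_rotor_twist[OF \<sigma>(1) assms(2) r] \<sigma>(2) \<rho>(2) by (simp add: comp_assoc)
  then show ?case using comp_in[OF \<sigma>(1) \<rho>(1)] by blast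
qed

section \<open>The two invariants determine a positive word\<close>

lemma mon_cong_window:
  assumes "u \<in> lists {1..n}" "l \<le> length u" "\<sigma> \<in> H"
  shows "(u, map \<sigma> (take l u) @ drop l u) \<in> mon_cong {1..n} (S_rels n l H)"
proof -
  have t: "take l u \<in> lists {1..n}" "drop l u \<in> lists {1..n}"
    using assms(1) by (auto dest: in_set_takeD in_set_dropD)
  have "(take l u, map \<sigma> (take l u)) \<in> S_rels n l H"
    unfolding S_rels_def using assms t by auto
  then have "(take l u @ drop l u, map \<sigma> (take l u) @ drop l u) \<in> mon_cong {1..n} (S_rels n l H)"
    using t map_in_lists[OF assms(3)] by (intro mc_append mc_rel mc_refl)
  then show ?thesis by simp
qed

text \<open>
  An entry of the register that the word does not reach shows that the diagonal factor \<open>\<sigma>\<close> is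
  trivial; then the remaining entries give the coordinates of the letters.
\<close>

lemma short_word_determined:
  assumes "length u < l" "map rep u = map rep v" "fs \<in> registers l" "\<sigma> \<in> H"
    and "fold rotor (map Inl u) fs = twist \<sigma> (fold rotor (map Inl v) fs)"
  shows "u = v"
proof -
  have len: "length v = length u" using assms(2) by (metis length_map)
  define gs hs where "gs = take (length u) fs" and "hs = drop (length u) fs"
  have fs: "fs = gs @ hs" "length gs = length u" "set gs \<subseteq> H" "set hs \<subseteq> H" "hs \<noteq> []"
    using assms(1,3) by (auto simp: gs_def hs_def registers_def dest: in_set_takeD in_set_dropD)
  have e: "hs @ map2 (\<lambda>i f. coord i \<circ> f) u gs
      = twist \<sigma> hs @ twist \<sigma> (map2 (\<lambda>i f. coord i \<circ> f) v gs)"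
    using assms(5) fold_rotor_positive[of u gs hs] fold_rotor_positive[of v gs hs]
    unfolding fs(1) by (simp add: fs(2) len)
  have "hs = twist \<sigma> hs \<and> map2 (\<lambda>i f. coord i \<circ> f) u gs
      = twist \<sigma> (map2 (\<lambda>i f. coord i \<circ> f) v gs)"
    by (rule append_eq_append_conv[THEN iffD1, OF _ e]) simp
  then have hs: "hs = twist \<sigma> hs" and gs: "map2 (\<lambda>i f. coord i \<circ> f) u gs
      = twist \<sigma> (map2 (\<lambda>i f. coord i \<circ> f) v gs)" by blast+
  have "hd hs \<in> H" using fs(4,5) by auto
  moreover have "\<sigma> \<circ> hd hs = id \<circ> hd hs"
    unfolding id_comp hd_map[OF fs(5), of "(\<circ>) \<sigma>", symmetric] using hs by (rule arg_cong[OF sym])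
  ultimately have "\<sigma> = id" by (rule comp_right_cancel[THEN iffD1])
  then have c: "map2 (\<lambda>i f. coord i \<circ> f) u gs = map2 (\<lambda>i f. coord i \<circ> f) v gs"
    using gs unfolding \<open>\<sigma> = id\<close> twist_id by blast
  have "length u = length gs" "length gs = length v" using fs(2) len by auto
  then show ?thesis using c assms(2) fs(3)
  proof (induction u gs v rule: list_induct3)
    case (Cons i u g gs j v)
    have "g \<in> H" "coord i \<circ> g = coord j \<circ> g" using Cons.prems by (simp_all add: comp_def)
    then have "coord i = coord j" by (rule comp_right_cancel[THEN iffD1])
    then have "i = j" by (rule coord_rep_inject) (use Cons.prems in simp)
    then show ?case using Cons by simp
  qed simp
qed

text \<open>
  Induction on the length, stripping the first letter once a relation has made it the same in both
  words.  That relation changes the diagonal factor and the stripped letter changes the register,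
  so both have to be arbitrary in the statement.
\<close>

lemma mon_cong_if_invariants_eq:
  assumes "0 < l"
    and "u \<in> lists {1..n}" "v \<in> lists {1..n}" "map rep u = map rep v"
    and "fs \<in> registers l" "\<sigma> \<in> H"
    and "fold rotor (map Inl u) fs = twist \<sigma> (fold rotor (map Inl v) fs)"
  shows "(u, v) \<in> mon_cong {1..n} (S_rels n l H)"
  using assms(2-)
proof (induction "length u" arbitrary: u v fs \<sigma> rule: less_induct)
  case less
  show ?case
  proof (cases "length u < l")
    case True
    then have "u = v" using short_word_determined less.prems by blast
    then show ?thesis using less.prems(1) by (auto intro: mc_refl)
  next
    case False
    then obtain a u' where u: "u = a # u'" using assms(1) by (cases u) auto
    then obtain b v' where v: "v = b # v'" using less.prems(3) by (cases v) auto
    (* The unique element of H that carries the letter a to the letter b of the same orbit. *)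
    define \<rho> where "\<rho> = coord b \<circ> inv' (coord a)"
    have \<rho>: "\<rho> \<in> H" by (simp add: \<rho>_def comp_in inv_in coord_in)
    have "rep a = rep b" using less.prems(3) by (simp add: u v)
    then have "\<rho> a = b"
      unfolding \<rho>_def using coord_rep inv_comp_app(1)[OF coord_in] by (metis comp_apply)
    define t where "t = map \<rho> (take (l - 1) u') @ drop (l - 1) u'"
    have bt: "map \<rho> (take l u) @ drop l u = b # t"
      using assms(1) \<open>\<rho> a = b\<close> by (cases l) (auto simp: u t_def)
    have step: "(u, b # t) \<in> mon_cong {1..n} (S_rels n l H)"
      using mon_cong_window[of u l \<rho>] less.prems(1) \<rho> False unfolding bt by simp
    have b: "b \<in> {1..n}" and t: "t \<in> lists {1..n}"
      using mon_cong_lists[OF step] by auto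
    have "map rep (b # t) = map rep u"
      unfolding bt[symmetric] using rep_app[OF \<rho>]
      by (metis (no_types, lifting) append_take_drop_id comp_apply map_append map_eq_conv map_map)
    then have rep: "map rep t = map rep v'" using less.prems(3) by (simp add: u v)
    have len: "length t = length u'" by (simp add: t_def)
    define fs' where "fs' = rotor (Inl b) fs"
    have fs': "fs' \<in> registers l"
      unfolding fs'_def using rotor_registers[OF assms(1) less.prems(4)] .
    have w: "take l u \<in> lists {1..n}" "length (take l u) = length fs"
      using less.prems(1,4) False by (auto simp: registers_def dest: in_set_takeD)
    have r: "fold rotor (map Inl (take l u)) fs \<in> registers l"
      using fold_rotor_registers[OF assms(1) less.prems(4)] .
    have "fold rotor (map Inl (b # t)) fs
        = fold rotor (map Inl (drop l u)) (twist \<rho> (fold rotor (map Inl (take l u)) fs))"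
      unfolding bt[symmetric] map_append fold_append comp_apply
        fold_rotor_window[OF \<rho> w] ..
    also have "\<dots> = twist \<rho> (fold rotor (map Inl (take l u @ drop l u)) fs)"
      by (simp only: map_append fold_append comp_apply fold_rotor_twist[OF \<rho> assms(1) r])
    also have "\<dots> = twist (\<rho> \<circ> \<sigma>) (fold rotor (map Inl v) fs)"
      using less.prems(6) by (simp only: append_take_drop_id twist_twist)
    finally have "fold rotor (map Inl t) fs' = twist (\<rho> \<circ> \<sigma>) (fold rotor (map Inl v') fs')"
      by (simp add: v fs'_def)
    then have "(t, v') \<in> mon_cong {1..n} (S_rels n l H)"
      using less.hyps[OF _ t _ rep fs' comp_in[OF \<rho> less.prems(5)]] less.prems(2) len
      by (simp add: u v)
    then have "([b] @ t, [b] @ v') \<in> mon_cong {1..n} (S_rels n l H)"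
      using b by (intro mc_append mc_refl) auto
    then show ?thesis using mc_trans[OF step] by (simp add: v)
  qed
qed

text \<open>
  The invariants are read off at the start values for which they have their meaning: zero, so that
  the affine value is a numeral, and the trivial register, so that its entries are the products
  of coordinates.
\<close>

lemma mon_cong_G_imp_S:
  assumes "0 < l" "u \<in> lists {1..n}" "v \<in> lists {1..n}"
    and "(map Inl u, map Inl v)
      \<in> mon_cong ({1..n} <+> {1..n}) (cancel_rels {1..n} \<union> G_rels n l H)"
  shows "(u, v) \<in> mon_cong {1..n} (S_rels n l H)"
proof -
  have fs: "replicate l id \<in> registers l" using id_in by (auto simp: registers_def)
  obtain \<sigma> where "\<sigma> \<in> H" "fold rotor (map Inl u) (replicate l id)
      = twist \<sigma> (fold rotor (map Inl v) (replicate l id))"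
    using rotor_invariant[OF assms(4,1) fs] by blast
  moreover have "map rep u = map rep v"
    using affine_positive_inject[OF assms(2,3)] affine_invariant[OF assms(4)] by simp
  ultimately show ?thesis using mon_cong_if_invariants_eq assms(1-3) fs by blast
qed

end

section \<open>Embedding into the universal group\<close>

theorem theorem2p5:
  fixes n l :: nat and H :: "(nat \<Rightarrow> nat) set"
  assumes "n \<ge> 1" and "l \<ge> 2"
    and "subgroup H (sym_group n)"
    and "comm_group (sym_group n \<lparr>carrier := H\<rparr>)"
    and "semiregular n H"
  shows "natural_map n l H \<in> hom (S_monoid n l H) (G_group n l H)
    \<and> natural_map n l H \<one>\<^bsub>S_monoid n l H\<^esub> = \<one>\<^bsub>G_group n l H\<^esub>
    \<and> (\<forall>i\<in>{1..n}. natural_map n l H (S_gen n l H i) = G_gen n l H i)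
    \<and> inj_on (natural_map n l H) (carrier (S_monoid n l H))"
proof -
  interpret semiregular_abelian n H using assms(3-5) by (rule semiregular_abelian.intro)
  have "inj_on (natural_map n l H) (carrier (S_monoid n l H))"
  proof (rule inj_onI)
    fix A B
    assume "A \<in> carrier (S_monoid n l H)" "B \<in> carrier (S_monoid n l H)"
      and eq: "natural_map n l H A = natural_map n l H B"
    then obtain u v where u: "u \<in> lists {1..n}" and v: "v \<in> lists {1..n}"
      and AB: "A = word_class {1..n} (S_rels n l H) u" "B = word_class {1..n} (S_rels n l H) v"
      by (auto simp: S_monoid_def carrier_monoid_pres)
    have "G_class n l H (map Inl u) = G_class n l H (map Inl v)"
      using eq unfolding AB natural_map_class[OF u] natural_map_class[OF v] .
    then have "(map Inl u, map Inl v)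
        \<in> mon_cong ({1..n} <+> {1..n}) (cancel_rels {1..n} \<union> G_rels n l H)"
      unfolding G_class_def word_class_eq_iff[OF map_Inl_lists[OF u] map_Inl_lists[OF v]] .
    then have "(u, v) \<in> mon_cong {1..n} (S_rels n l H)"
      using mon_cong_G_imp_S u v assms(2) by simp
    then show "A = B" unfolding AB word_class_eq_iff[OF u v] .
  qed
  then show ?thesis using natural_map_hom natural_map_one natural_map_gen by blast
qed

end
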